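(* Let $Y$ be a set with $|Y| \geq 3$ and let $Q = \{\Delta_Y, \nabla_Y\}$, where $\Delta_Y = \{\langle y, y\rangle : y \in Y\}$ is the diagonal of $Y$ and $\nabla_Y = Y^2 \setminus \Delta_Y$. Then $Q$ is a partition of $Y^2$, and the subsemigroup $(\mathcal{S}_Q, \circ)$ of $\mathcal{B}_Y$ has no $d$-transitive monomorphism $\mathcal{S}_Q \to \mathcal{B}_X$ for any set $X$.
   Context: $\mathcal{B}_X$ is the semigroup of all binary relations on a set $X$ (subsets of $X^2$) under composition: $\langle x,y\rangle \in \psi \circ \gamma$ iff there is $z \in X$ with $\langle x,z\rangle \in \psi$ and $\langle z,y\rangle \in \gamma$. For a nonempty set $Q$ of binary relations on $Y$, $\mathcal{S}_Q$ is the subsemigroup of $\mathcal{B}_Y$ generated by $Q$. A zero of a semigroup is an element $\theta$ with $\theta * s = s * \theta = \theta$ for all $s$; by convention a semigroup must have at least two elements to possess a zero. A monomorphism is an injective homomorphism. A partition of a nonempty set is a set of nonempty pairwise disjoint subsets whose union is the whole set; there is no partition of $\varnothing$. A set $A \subseteq \mathcal{S}$ is a set of generators of a semigroup $\mathcal{S}$ if every element of $\mathcal{S}$ is a product of a finite sequence (of length at least one) of elements of $A$. A monomorphism $\Phi : \mathcal{S} \to \mathcal{B}_X$ is $d$-transitive if there is a set $A$ of generators of $\mathcal{S}$ such that $\{\Phi(a) : a \in A\}$ is a partition of $X^2$ and, if $\mathcal{S}$ contains a zero element $\theta$, then $\Phi(\theta) = \varnothing$. *)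

theory Defs
  imports Main "HOL-Library.Disjoint_Sets"
begin

definition semigroup_on :: "'s set \<Rightarrow> ('s \<Rightarrow> 's \<Rightarrow> 's) \<Rightarrow> bool" where
  "semigroup_on S f \<longleftrightarrow>
     (\<forall>a\<in>S. \<forall>b\<in>S. f a b \<in> S) \<and>
     (\<forall>a\<in>S. \<forall>b\<in>S. \<forall>c\<in>S. f (f a b) c = f a (f b c))"

text \<open>The semigroup of all binary relations on \<open>X\<close> has this carrier and the operation
  \<^const>\<open>relcomp\<close>, written \<open>(O)\<close>, which composes from left to right:
  \<open>(x, y) \<in> r O s\<close> iff \<open>(x, z) \<in> r\<close> and \<open>(z, y) \<in> s\<close> for some \<open>z\<close>.\<close>

definition binrels :: "'a set \<Rightarrow> 'a rel set" where
  "binrels X = Pow (X \<times> X)"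

inductive_set generated_subsemigroup :: "('s \<Rightarrow> 's \<Rightarrow> 's) \<Rightarrow> 's set \<Rightarrow> 's set"
  for f :: "'s \<Rightarrow> 's \<Rightarrow> 's" and Q :: "'s set" where
  base: "q \<in> Q \<Longrightarrow> q \<in> generated_subsemigroup f Q"
| mult: "\<lbrakk>a \<in> generated_subsemigroup f Q; b \<in> generated_subsemigroup f Q\<rbrakk>
    \<Longrightarrow> f a b \<in> generated_subsemigroup f Q"

text \<open>\<open>foldl f a as\<close> is the product of the nonempty sequence \<open>a # as\<close>.\<close>

definition generating_set :: "'s set \<Rightarrow> ('s \<Rightarrow> 's \<Rightarrow> 's) \<Rightarrow> 's set \<Rightarrow> bool" where
  "generating_set S f A \<longleftrightarrow>
     A \<subseteq> S \<and> (\<forall>s\<in>S. \<exists>a as. a \<in> A \<and> set as \<subseteq> A \<and> s = foldl f a as)"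

text \<open>A one-element semigroup has no zero, by convention.\<close>

definition is_zero :: "'s set \<Rightarrow> ('s \<Rightarrow> 's \<Rightarrow> 's) \<Rightarrow> 's \<Rightarrow> bool" where
  "is_zero S f z \<longleftrightarrow>
     z \<in> S \<and> (\<exists>a\<in>S. \<exists>b\<in>S. a \<noteq> b) \<and> (\<forall>s\<in>S. f z s = z \<and> f s z = z)"

definition monomorphism ::
    "'s set \<Rightarrow> ('s \<Rightarrow> 's \<Rightarrow> 's) \<Rightarrow> 't set \<Rightarrow> ('t \<Rightarrow> 't \<Rightarrow> 't) \<Rightarrow> ('s \<Rightarrow> 't) \<Rightarrow> bool" where
  "monomorphism S f T g \<Phi> \<longleftrightarrow>
     \<Phi> ` S \<subseteq> T \<and> inj_on \<Phi> S \<and> (\<forall>a\<in>S. \<forall>b\<in>S. \<Phi> (f a b) = g (\<Phi> a) (\<Phi> b))"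

text \<open>Unlike with \<^const>\<open>partition_on\<close>, the empty set has no partition.\<close>

definition is_partition :: "'a set \<Rightarrow> 'a set set \<Rightarrow> bool" where
  "is_partition A P \<longleftrightarrow> A \<noteq> {} \<and> partition_on A P"

definition d_transitive_monomorphism ::
    "'s set \<Rightarrow> ('s \<Rightarrow> 's \<Rightarrow> 's) \<Rightarrow> 'b set \<Rightarrow> ('s \<Rightarrow> 'b rel) \<Rightarrow> bool" where
  "d_transitive_monomorphism S f X \<Phi> \<longleftrightarrow>
     monomorphism S f (binrels X) (O) \<Phi> \<and>
     (\<exists>A. generating_set S f A \<and> is_partition (X \<times> X) (\<Phi> ` A)) \<and>
     (\<forall>z. is_zero S f z \<longrightarrow> \<Phi> z = {})"

lemma semigroup_on_binrels: "semigroup_on (binrels X) (O)"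
  unfolding semigroup_on_def binrels_def by (auto simp: O_assoc)

lemma generated_subsemigroup_subset:
  assumes "semigroup_on S f" "Q \<subseteq> S"
  shows "generated_subsemigroup f Q \<subseteq> S"
proof
  fix s assume "s \<in> generated_subsemigroup f Q"
  then show "s \<in> S"
    by induction (use assms in \<open>auto simp: semigroup_on_def\<close>)
qed

lemma semigroup_on_generated_subsemigroup:
  assumes "semigroup_on S f" "Q \<subseteq> S"
  shows "semigroup_on (generated_subsemigroup f Q) f"
  using generated_subsemigroup_subset[OF assms] assms(1)
  unfolding semigroup_on_def
  by (meson generated_subsemigroup.mult subsetD)

end

theory Submission imports Defs begin

text \<open>The semigroup generated by the diagonal \<open>\<Delta>\<close> and its complement \<open>\<nabla>\<close> consists of \<open>\<Delta>\<close>,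
  \<open>\<nabla>\<close> and the zero \<open>\<nabla> \<circ> \<nabla> = Y\<^sup>2\<close>. A \<open>d\<close>-transitive monomorphism \<open>\<Phi>\<close> sends the zero to \<open>\<emptyset>\<close>, so
  \<open>\<Phi> \<nabla>\<close> is nonempty by injectivity. If \<open>(x, y) \<in> \<Phi> \<nabla>\<close>, then \<open>(y, x)\<close> lies in \<open>\<Phi> \<Delta>\<close> or in
  \<open>\<Phi> \<nabla>\<close>. In the first case \<open>(x, x) \<in> \<Phi> (\<nabla> \<circ> \<Delta>) = \<Phi> \<nabla>\<close>, so in both cases \<open>\<Phi> \<nabla> \<circ> \<Phi> \<nabla>\<close> contains
  \<open>(x, x)\<close>, although it equals \<open>\<Phi> (\<nabla> \<circ> \<nabla>) = \<emptyset>\<close>.\<close>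

text \<open>Since \<open>card\<close> is 0 on infinite sets, the bound on the size of
  \<open>Y\<close> takes the form of a disjunction.\<close>

lemma exists_third_element:
  assumes "infinite Y \<or> 3 \<le> card Y"
  shows "\<exists>z\<in>Y. z \<noteq> x \<and> z \<noteq> y"
proof (rule ccontr)
  assume "\<not> ?thesis"
  then have sub: "Y \<subseteq> {x, y}" by blast
  have "card {x, y} \<le> 2" by (simp add: card_insert_if)
  with sub have "card Y \<le> 2"
    using card_mono[of "{x, y}" Y] by simp
  moreover have "finite Y" using sub finite_subset by blast
  ultimately show False using assms by simp
qed

text \<open>Any two points, equal or not, are joined through a point different from both.\<close>

lemma off_diagonal_relcomp:
  assumes "infinite Y \<or> 3 \<le> card Y"
  shows "(Y \<times> Y - Id_on Y) O (Y \<times> Y - Id_on Y) = Y \<times> Y"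
    and "(Y \<times> Y - Id_on Y) O (Y \<times> Y) = Y \<times> Y"
    and "(Y \<times> Y) O (Y \<times> Y - Id_on Y) = Y \<times> Y"
  using exists_third_element[OF assms] by (fastforce simp: relcomp_unfold)+

lemma generated_subsemigroup_diagonal:
  assumes "infinite Y \<or> 3 \<le> card Y"
  shows "generated_subsemigroup (O) {Id_on Y, Y \<times> Y - Id_on Y}
    = {Id_on Y, Y \<times> Y - Id_on Y, Y \<times> Y}"
proof (intro equalityI subsetI)
  fix r assume "r \<in> generated_subsemigroup (O) {Id_on Y, Y \<times> Y - Id_on Y}"
  then show "r \<in> {Id_on Y, Y \<times> Y - Id_on Y, Y \<times> Y}"
  proof induction
    \<comment> \<open>\<open>Id_on Y\<close> is neutral, and all products of the other two elements
      are \<open>Y \<times> Y\<close>.\<close>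
    case (mult a b)
    have "Id_on Y O r = r" "r O Id_on Y = r" if "r \<subseteq> Y \<times> Y" for r
      using that by auto
    moreover have "Id_on Y \<subseteq> Y \<times> Y" "Y \<times> Y - Id_on Y \<subseteq> Y \<times> Y" by auto
    moreover have "(Y \<times> Y) O (Y \<times> Y) = Y \<times> Y" by blast
    ultimately show ?case
      using mult.IH off_diagonal_relcomp[OF assms] by auto
  qed auto
next
  fix r assume "r \<in> {Id_on Y, Y \<times> Y - Id_on Y, Y \<times> Y}"
  then show "r \<in> generated_subsemigroup (O) {Id_on Y, Y \<times> Y - Id_on Y}"
    using generated_subsemigroup.mult[of "Y \<times> Y - Id_on Y" "(O)"
        "{Id_on Y, Y \<times> Y - Id_on Y}" "Y \<times> Y - Id_on Y"]
    by (auto simp: off_diagonal_relcomp(1)[OF assms] intro: generated_subsemigroup.base)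
qed

theorem proposition4p14:
  fixes Y :: "'a set" and Q :: "'a rel set" and X :: "'b set"
  assumes "infinite Y \<or> 3 \<le> card Y"
    and "Q = {Id_on Y, Y \<times> Y - Id_on Y}"
  shows "is_partition (Y \<times> Y) Q \<and>
    \<not> (\<exists>\<Phi>. d_transitive_monomorphism (generated_subsemigroup (O) Q) (O) X \<Phi>)"
proof
  let ?D = "Id_on Y" and ?N = "Y \<times> Y - Id_on Y"
  obtain y0 where y0: "y0 \<in> Y"
    using exists_third_element[OF assms(1)] by blast
  obtain y1 where y1: "y1 \<in> Y" "y1 \<noteq> y0"
    using exists_third_element[OF assms(1)] by blast
  \<comment> \<open>These pairs show that both blocks are nonempty.\<close>
  have D: "(y0, y0) \<in> ?D" "(y0, y0) \<notin> ?N" and N: "(y0, y1) \<in> ?N"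
    using y0 y1 by auto
  show "is_partition (Y \<times> Y) Q"
    unfolding is_partition_def partition_on_def disjoint_def assms(2)
    using y0 D N by auto
  show "\<not> (\<exists>\<Phi>. d_transitive_monomorphism (generated_subsemigroup (O) Q) (O) X \<Phi>)"
  proof
    let ?S = "generated_subsemigroup (O) Q"
    have S: "?S = {?D, ?N, Y \<times> Y}"
      using generated_subsemigroup_diagonal[OF assms(1)] assms(2) by simp
    have ND: "?N O ?D = ?N" by auto
    \<comment> \<open>The convention on zeros asks for two distinct elements; injectivity later
      separates the images of these two.\<close>
    have neq: "?N \<noteq> Y \<times> Y" using y0 D by blast
    have "is_zero ?S (O) (Y \<times> Y)"
      unfolding is_zero_def S
      using neq off_diagonal_relcomp[OF assms(1)] by auto
    moreover assume "\<exists>\<Phi>. d_transitive_monomorphism ?S (O) X \<Phi>"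
    then obtain \<Phi> A where mono: "monomorphism ?S (O) (binrels X) (O) \<Phi>"
      and gen: "generating_set ?S (O) A" and part: "is_partition (X \<times> X) (\<Phi> ` A)"
      and zero: "\<And>z. is_zero ?S (O) z \<Longrightarrow> \<Phi> z = {}"
      unfolding d_transitive_monomorphism_def by blast
    ultimately have empty: "\<Phi> (Y \<times> Y) = {}" by simp
    have inj: "inj_on \<Phi> ?S" and sub: "\<Phi> ?N \<subseteq> X \<times> X"
      and hom: "\<And>a b. a \<in> ?S \<Longrightarrow> b \<in> ?S \<Longrightarrow> \<Phi> (a O b) = \<Phi> a O \<Phi> b"
      using mono S unfolding monomorphism_def binrels_def by auto
    have NN: "\<Phi> ?N O \<Phi> ?N = {}"
      using hom[of ?N ?N] S empty off_diagonal_relcomp(1)[OF assms(1)] by simp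
    have "\<Phi> ?N \<noteq> {}"
      using inj_onD[OF inj, of ?N "Y \<times> Y"] neq S empty by auto
    then obtain x y where xy: "(x, y) \<in> \<Phi> ?N" by auto
    then have "(y, x) \<in> X \<times> X" using sub by blast
    then obtain a where a: "a \<in> A" "(y, x) \<in> \<Phi> a"
      using part unfolding is_partition_def partition_on_def by blast
    have "a \<in> {?D, ?N, Y \<times> Y}"
      using a(1) gen S unfolding generating_set_def by blast
    \<comment> \<open>As \<open>\<Phi> a\<close> contains \<open>(y, x)\<close>, \<open>a\<close> is
      not the zero.\<close>
    then consider "a = ?D" | "a = ?N" using a(2) empty by auto
    then show False
    proof cases
      case 1
      have "(x, x) \<in> \<Phi> ?N O \<Phi> ?D" using xy a(2) 1 by blast
      also have "\<dots> = \<Phi> ?N" using hom[of ?N ?D] S ND by simp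
      finally show False using NN by blast
    next
      case 2
      then show False using xy a(2) NN by blast
    qed
  qed
qed

end
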